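(* Let $W\in\mathbb{R}^{N\times N}$ be any (row-)stochastic primitive matrix with $W_{ii}>0$ for all $i$, and let $x_0\in\mathbb{R}^N$ be any initial state with $x_0\not\parallel\mathbf{1}$. Let $v$ be the Perron eigenvector of $W$ and $x_{\mathrm{ss}}:=v^\top x_0$. Then there exists a sequence $\{\boldsymbol{\lambda}_t\}_{t\ge0}$ of vectors $\boldsymbol{\lambda}_t\in[0,1]^N$ with $\lim_{t\to\infty}\boldsymbol{\lambda}_t=0$ such that the trajectory generated from $x_0$ by $$x_{t+1}=\mathrm{diag}(\mathbf{1}-\boldsymbol{\lambda}_t)Wx_t+\mathrm{diag}(\boldsymbol{\lambda}_t)x_0,\qquad t\ge0,$$ has a limit satisfying $\lim_{t\to\infty}x_t\neq x_{\mathrm{ss}}\mathbf{1}$.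
   Context: $\mathbf{1}\in\mathbb{R}^N$ is the all-ones vector. A matrix $W$ is (row-)stochastic if all its entries are nonnegative and $W\mathbf{1}=\mathbf{1}$; it is primitive if some power has all positive entries. The Perron eigenvector $v$ of a stochastic primitive matrix $W$ is the unique stochastic vector (nonnegative entries summing to $1$) with $W^\top v=v$. $x_0\not\parallel\mathbf{1}$ means that $x_0$ is not a scalar multiple of $\mathbf{1}$. $\mathrm{diag}(a)$ is the diagonal matrix with the entries of the vector $a$ on its diagonal. *)

theory Defs
  imports "HOL-Analysis.Analysis"
begin

text \<open>Componentwise nonnegative with unit sum.\<close>
definition stochastic_vector :: "real ^ 'n \<Rightarrow> bool" where
  "stochastic_vector v \<longleftrightarrow> (\<forall>i. 0 \<le> v $ i) \<and> (\<Sum>i\<in>UNIV. v $ i) = 1"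

definition stochastic_matrix :: "real ^ 'n ^ 'n \<Rightarrow> bool" where
  "stochastic_matrix W \<longleftrightarrow> (\<forall>i j. 0 \<le> W $ i $ j) \<and> W *v 1 = 1"

text \<open>
  On the type \<open>real ^ 'n ^ 'n\<close>, \<open>*\<close> is the entrywise product and \<open>1\<close> the all-ones matrix,
  so powers of matrices are formed by iterating \<open>**\<close> from \<open>mat 1\<close>. On \<open>real ^ 'n\<close>, on the
  other hand, \<open>1\<close> is the all-ones vector.
\<close>
definition matrix_power :: "real ^ 'n ^ 'n \<Rightarrow> nat \<Rightarrow> real ^ 'n ^ 'n" where
  "matrix_power A k = (((**) A) ^^ k) (mat 1)"

definition primitive_matrix :: "real ^ 'n ^ 'n \<Rightarrow> bool" where
  "primitive_matrix A \<longleftrightarrow> (\<exists>k\<ge>1. \<forall>i j. 0 < matrix_power A k $ i $ j)"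

text \<open>There is exactly one such vector when \<open>W\<close> is stochastic and primitive.\<close>
definition perron_vector :: "real ^ 'n ^ 'n \<Rightarrow> real ^ 'n" where
  "perron_vector W = (THE v. stochastic_vector v \<and> transpose W *v v = v)"

definition diag :: "real ^ 'n \<Rightarrow> real ^ 'n ^ 'n" where
  "diag a = (\<chi> i j. if i = j then a $ i else 0)"

primrec trajectory ::
    "real ^ 'n ^ 'n \<Rightarrow> (nat \<Rightarrow> real ^ 'n) \<Rightarrow> real ^ 'n \<Rightarrow> nat \<Rightarrow> real ^ 'n" where
  "trajectory W lam x0 0 = x0"
| "trajectory W lam x0 (Suc t) =
     diag (1 - lam t) *v (W *v trajectory W lam x0 t) + diag (lam t) *v x0"

end

theory Submission
  imports Defs
begin

text \<open>
  The idea: a single perturbation at time 0 suffices. Take \<open>lam 0\<close> to be the unit vector at a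
  coordinate \<open>i\<close> with \<open>(W x0)\<^sub>i \<noteq> x0\<^sub>i\<close>, which exists because only multiples of \<open>1\<close> are fixed by
  \<open>W\<close>, and \<open>lam t = 0\<close> afterwards. Then the trajectory follows the powers of \<open>W\<close> from \<open>x 1\<close> on and
  converges to \<open>(v \<bullet> x 1) 1\<close>. Since \<open>v\<close> is positive and invariant,
  \<open>v \<bullet> x 1 - v \<bullet> x0 = v\<^sub>i (x0 - W x0)\<^sub>i \<noteq> 0\<close>.

  The powers converge because the spread between largest and smallest coordinate never increases
  under \<open>W\<close> and shrinks by a fixed factor under a positive power of \<open>W\<close>.
\<close>

section \<open>Extreme coordinates under a stochastic matrix\<close>

definition coord_max :: "real ^ 'n \<Rightarrow> real" where
  "coord_max x = Max (range (($) x))"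

definition coord_min :: "real ^ 'n \<Rightarrow> real" where
  "coord_min x = Min (range (($) x))"

lemma le_coord_max: "x $ i \<le> coord_max x"
  by (simp add: coord_max_def)

lemma coord_min_le: "coord_min x \<le> x $ i"
  by (simp add: coord_min_def)

lemma coord_max_leI: "(\<And>i. x $ i \<le> c) \<Longrightarrow> coord_max x \<le> c"
  by (simp add: coord_max_def)

lemma coord_min_geI: "(\<And>i. c \<le> x $ i) \<Longrightarrow> c \<le> coord_min x"
  by (simp add: coord_min_def)

lemma coord_min_le_max: "coord_min x \<le> coord_max x"
  using coord_min_le le_coord_max order_trans by blast

lemma coord_min_attained: "\<exists>i. x $ i = coord_min x"
proof -
  have "coord_min x \<in> range (($) x)"
    unfolding coord_min_def by (rule Min_in) auto
  then show ?thesis by auto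
qed

lemma stochastic_matrix_nonneg: "stochastic_matrix W \<Longrightarrow> 0 \<le> W $ i $ j"
  by (simp add: stochastic_matrix_def)

lemma stochastic_matrix_row_sum:
  assumes "stochastic_matrix W"
  shows "(\<Sum>j\<in>UNIV. W $ i $ j) = 1"
proof -
  have "(W *v 1) $ i = 1"
    using assms by (simp add: stochastic_matrix_def)
  then show ?thesis
    by (simp add: matrix_vector_mult_def)
qed

text \<open>Row \<open>i\<close> of \<open>W\<close> averages the nonnegative gaps
  \<open>coord_max x - x $ j\<close>, and the term of a minimal coordinate alone contributes at
  least \<open>d\<close> times the spread. The case \<open>d = 0\<close> gives monotonicity of the
  maximum, a positive \<open>d\<close> gives the contraction.\<close>

lemma stochastic_coord_bound:
  assumes W: "stochastic_matrix W" and d: "\<And>i j. d \<le> W $ i $ j"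
  shows "(W *v x) $ i \<le> coord_max x - d * (coord_max x - coord_min x)"
proof -
  obtain j where j: "x $ j = coord_min x"
    using coord_min_attained by blast
  have "d * (coord_max x - coord_min x) \<le> W $ i $ j * (coord_max x - x $ j)"
    using d[of i j] j coord_min_le_max[of x] by (simp add: mult_right_mono)
  also have "\<dots> \<le> (\<Sum>j\<in>UNIV. W $ i $ j * (coord_max x - x $ j))"
    by (rule member_le_sum)
      (auto simp: stochastic_matrix_nonneg[OF W] le_coord_max)
  also have "\<dots> = coord_max x - (W *v x) $ i"
    by (simp add: right_diff_distrib sum_subtractf stochastic_matrix_row_sum[OF W]
        matrix_vector_mult_def flip: sum_distrib_right)
  finally show ?thesis by simp
qed

lemma coord_max_stochastic_le: "stochastic_matrix W \<Longrightarrow> coord_max (W *v x) \<le> coord_max x"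
  using stochastic_coord_bound[of W 0 x] stochastic_matrix_nonneg
  by (intro coord_max_leI) force

lemma coord_min_stochastic_ge:
  assumes W: "stochastic_matrix W"
  shows "coord_min x \<le> coord_min (W *v x)"
proof (rule coord_min_geI)
  fix i
  have "coord_min x = (\<Sum>j\<in>UNIV. W $ i $ j * coord_min x)"
    by (simp add: stochastic_matrix_row_sum[OF W] flip: sum_distrib_right)
  also have "\<dots> \<le> (\<Sum>j\<in>UNIV. W $ i $ j * x $ j)"
    by (intro sum_mono mult_left_mono coord_min_le stochastic_matrix_nonneg[OF W])
  also have "\<dots> = (W *v x) $ i"
    by (simp add: matrix_vector_mult_def)
  finally show "coord_min x \<le> (W *v x) $ i" .
qed

text \<open>The maximum drops by \<open>d\<close> times the spread while the minimum does not fall,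
  so bounding one end suffices.\<close>

lemma coord_spread_contraction:
  assumes W: "stochastic_matrix W" and "\<And>i j. d \<le> W $ i $ j"
  shows "coord_max (W *v x) - coord_min (W *v x) \<le> (1 - d) * (coord_max x - coord_min x)"
proof -
  have "coord_max (W *v x) \<le> coord_max x - d * (coord_max x - coord_min x)"
    by (intro coord_max_leI stochastic_coord_bound assms)
  with coord_min_stochastic_ge[OF W, of x] show ?thesis
    by (simp add: algebra_simps)
qed

section \<open>Convergence of the powers of a primitive stochastic matrix\<close>

lemma matrix_power_mult_vector: "matrix_power A k *v x = ((*v) A ^^ k) x"
  unfolding matrix_power_def
  by (induction k) (simp_all flip: matrix_vector_mul_assoc)

lemma stochastic_matrix_mult:
  assumes "stochastic_matrix A" "stochastic_matrix B"
  shows "stochastic_matrix (A ** B)"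
  using assms unfolding stochastic_matrix_def
  by (metis (no_types, lifting) matrix_vector_mul_assoc sum_nonneg mult_nonneg_nonneg
      matrix_matrix_mult_def vec_lambda_beta)

lemma stochastic_matrix_power:
  assumes "stochastic_matrix A"
  shows "stochastic_matrix (matrix_power A k)"
proof (induction k)
  case 0
  have "0 \<le> (mat 1 :: real ^ 'a ^ 'a) $ i $ j" for i j
    by (simp add: mat_def)
  then show ?case by (simp add: matrix_power_def stochastic_matrix_def)
next
  case (Suc k)
  then show ?case
    using stochastic_matrix_mult[OF assms] by (simp add: matrix_power_def)
qed

lemma primitive_matrix_power_bound:
  fixes W :: "real ^ 'n ^ 'n"
  assumes "primitive_matrix W"
  shows "\<exists>d>0. \<exists>k. \<forall>i j. d \<le> matrix_power W k $ i $ j"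
proof -
  obtain k where k: "\<And>i j. 0 < matrix_power W k $ i $ j"
    using assms by (auto simp: primitive_matrix_def)
  let ?S = "range (\<lambda>(i, j). matrix_power W k $ i $ j)"
  have "0 < Min ?S"
    using k by auto
  moreover have "Min ?S \<le> matrix_power W k $ i $ j" for i j
    by (rule Min_le) (auto intro: image_eqI[where x = "(i, j)"])
  ultimately show ?thesis
    by blast
qed

lemma primitive_powers_converge:
  fixes W :: "real ^ 'n ^ 'n"
  assumes W: "stochastic_matrix W" and prim: "primitive_matrix W"
  shows "\<exists>c. (\<lambda>t. ((*v) W ^^ t) x) \<longlonglongrightarrow> c *\<^sub>R 1"
proof -
  obtain d k where d: "0 < d" "\<And>i j. d \<le> matrix_power W k $ i $ j"
    using primitive_matrix_power_bound[OF prim] by auto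
  define y where "y t = ((*v) W ^^ t) x" for t
  define M where "M t = coord_max (y t)" for t
  define m where "m t = coord_min (y t)" for t
  have "decseq M"
    by (rule decseq_SucI) (simp add: M_def y_def coord_max_stochastic_le[OF W])
  have "incseq m"
    by (rule incseq_SucI) (simp add: m_def y_def coord_min_stochastic_ge[OF W])
  have mM: "m t \<le> M t" for t
    by (simp add: m_def M_def coord_min_le_max)
  have "m 0 \<le> M t" for t
    using incseqD[OF \<open>incseq m\<close>, of 0 t] mM[of t] by simp
  then obtain c where c: "M \<longlonglongrightarrow> c"
    using decseq_convergent[OF \<open>decseq M\<close>, of "m 0"] by blast
  have "m t \<le> M 0" for t
    using decseqD[OF \<open>decseq M\<close>, of 0 t] mM[of t] by simp
  then obtain b where b: "m \<longlonglongrightarrow> b"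
    using incseq_convergent[OF \<open>incseq m\<close>, of "M 0"] by blast
  \<comment> \<open>\<open>W\<close> itself may have zero entries, so the contraction is seen only
    over blocks of \<open>k\<close> steps, through the positive matrix
    \<open>matrix_power W k\<close>.\<close>
  have "M (t + k) - m (t + k) \<le> (1 - d) * (M t - m t)" for t
  proof -
    have "y (t + k) = matrix_power W k *v y t"
      unfolding y_def matrix_power_mult_vector by (subst add.commute) (simp add: funpow_add)
    with coord_spread_contraction[OF stochastic_matrix_power[OF W] d(2), of "y t"]
    show ?thesis
      by (simp only: M_def m_def)
  qed
  \<comment> \<open>Letting \<open>t\<close> grow with \<open>k\<close> fixed turns the contraction
    into an inequality between the limits, which a positive gap \<open>c - b\<close> would violate;
    no geometric rate enters.\<close>
  then have "c - b \<le> (1 - d) * (c - b)"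
    using LIMSEQ_ignore_initial_segment[OF c, of k] LIMSEQ_ignore_initial_segment[OF b, of k]
    by (blast intro: LIMSEQ_le[OF tendsto_diff tendsto_mult_left[OF tendsto_diff[OF c b]]])
  then have "d * (c - b) \<le> 0"
    by (simp add: algebra_simps)
  then have "c \<le> b"
    using d(1) by (simp add: mult_le_0_iff)
  moreover have "b \<le> c"
    using LIMSEQ_le[OF b c] mM by auto
  ultimately have "b = c" by simp
  have "(\<lambda>t. y t $ i) \<longlonglongrightarrow> c" for i
    by (rule tendsto_sandwich[OF _ _ b[unfolded \<open>b = c\<close>] c])
      (simp_all add: m_def M_def coord_min_le le_coord_max)
  then have "y \<longlonglongrightarrow> c *\<^sub>R 1"
    by (intro vec_tendstoI) simp
  then show ?thesis
    unfolding y_def by blast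
qed

section \<open>The Perron vector: existence, uniqueness, positivity\<close>

lemma inner_mult_invariant:
  fixes W :: "real ^ 'n ^ 'n"
  assumes "transpose W *v v = v"
  shows "v \<bullet> (W *v x) = v \<bullet> x"
  by (metis assms dot_lmul_matrix vector_transpose_matrix transpose_transpose)

lemma stochastic_vector_inner_one: "stochastic_vector v \<Longrightarrow> v \<bullet> 1 = 1"
  by (simp add: stochastic_vector_def inner_vec_def)

text \<open>The inner product with \<open>v\<close> is conserved along the orbit, and at the limit
  \<open>c *\<^sub>R 1\<close> it equals \<open>c\<close>. This also drives the uniqueness of
  \<open>v\<close>.\<close>

lemma invariant_vector_limit:
  fixes W :: "real ^ 'n ^ 'n"
  assumes "stochastic_matrix W" "primitive_matrix W"
    and v: "stochastic_vector v" "transpose W *v v = v"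
  shows "(\<lambda>t. ((*v) W ^^ t) x) \<longlonglongrightarrow> (v \<bullet> x) *\<^sub>R 1"
proof -
  obtain c where c: "(\<lambda>t. ((*v) W ^^ t) x) \<longlonglongrightarrow> c *\<^sub>R 1"
    using primitive_powers_converge assms(1,2) by blast
  have "v \<bullet> ((*v) W ^^ t) x = v \<bullet> x" for t
    by (induction t) (simp_all add: inner_mult_invariant[OF v(2)])
  then have "(\<lambda>t. v \<bullet> x) \<longlonglongrightarrow> v \<bullet> (c *\<^sub>R 1)"
    using tendsto_inner[OF tendsto_const c, of v] by simp
  then have "v \<bullet> x = c"
    using stochastic_vector_inner_one[OF v(1)] by (simp add: LIMSEQ_const_iff)
  with c show ?thesis by simp
qed

text \<open>The common limit \<open>c x\<close> of the coordinates of the orbit of \<open>x\<close>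
  is a linear functional of \<open>x\<close>; the vector representing it is the invariant
  vector.\<close>

lemma invariant_vector_exists:
  fixes W :: "real ^ 'n ^ 'n"
  assumes W: "stochastic_matrix W" and prim: "primitive_matrix W"
  shows "\<exists>v. stochastic_vector v \<and> transpose W *v v = v"
proof -
  obtain c where c: "\<And>x. (\<lambda>t. ((*v) W ^^ t) x) \<longlonglongrightarrow> c x *\<^sub>R 1"
    using primitive_powers_converge[OF W prim] by metis
  have coord: "(\<lambda>t. (((*v) W ^^ t) x) $ i) \<longlonglongrightarrow> c x" for x i
    using tendsto_vec_nth[OF c[of x], of i] by simp
  note mult = matrix_power_mult_vector[of W, symmetric]
  define v where "v = (\<chi> i. c (axis i 1))"
  have c_inner: "c x = v \<bullet> x" for x
  proof -
    \<comment> \<open>Any coordinate will do, since all coordinates of the orbit have the same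
      limit.\<close>
    fix i :: 'n
    have "(((*v) W ^^ t) x) $ i = (\<Sum>j\<in>UNIV. (((*v) W ^^ t) (axis j 1)) $ i * x $ j)" for t
      by (simp add: mult matrix_vector_mul_component matrix_vector_mult_basis column_def inner_vec_def)
    moreover have "(\<lambda>t. \<Sum>j\<in>UNIV. (((*v) W ^^ t) (axis j 1)) $ i * x $ j) \<longlonglongrightarrow> v \<bullet> x"
      unfolding inner_vec_def v_def by (auto intro!: tendsto_intros coord)
    ultimately show ?thesis
      using LIMSEQ_unique[OF coord[of x i]] by simp
  qed
  have "0 \<le> v $ j" for j
  proof -
    fix i :: 'n
    have "0 \<le> (((*v) W ^^ t) (axis j 1)) $ i" for t
      using stochastic_matrix_nonneg[OF stochastic_matrix_power[OF W]]
      by (simp add: mult matrix_vector_mult_basis column_def)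
    then show ?thesis
      unfolding v_def using LIMSEQ_le_const[OF coord[of "axis j 1" i], of 0] by simp
  qed
  moreover have "v \<bullet> 1 = 1"
  proof -
    fix i :: 'n
    have "((*v) W ^^ t) 1 = 1" for t
      using stochastic_matrix_power[OF W] by (simp add: mult stochastic_matrix_def)
    then show ?thesis
      using coord[of 1 i] by (simp add: LIMSEQ_const_iff flip: c_inner)
  qed
  ultimately have "stochastic_vector v"
    by (simp add: stochastic_vector_def inner_vec_def)
  moreover have "transpose W *v v = v"
  proof (rule vector_eq_rdot[THEN iffD1], rule allI)
    fix x
    fix i :: 'n
    \<comment> \<open>The orbit of \<open>W *v x\<close> is that of \<open>x\<close> shifted by one
      step, hence has the same limit.\<close>
    have "(\<lambda>t. (((*v) W ^^ t) (W *v x)) $ i) \<longlonglongrightarrow> c x"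
      using LIMSEQ_Suc[OF coord[of x i]] by (simp only: funpow_Suc_right o_apply)
    then have "v \<bullet> (W *v x) = v \<bullet> x"
      using LIMSEQ_unique[OF coord] by (metis c_inner)
    then show "(transpose W *v v) \<bullet> x = v \<bullet> x"
      by (simp add: dot_lmul_matrix)
  qed
  ultimately show ?thesis by blast
qed

text \<open>Justifies the definite description: for two invariant stochastic vectors
  \<open>u\<close> and \<open>v\<close>, both \<open>u \<bullet> x\<close> and
  \<open>v \<bullet> x\<close> are read off from the limit of the orbit of \<open>x\<close>.\<close>

lemma perron_vector:
  fixes W :: "real ^ 'n ^ 'n"
  assumes W: "stochastic_matrix W" and prim: "primitive_matrix W"
  shows "stochastic_vector (perron_vector W)" (is ?stoch)
    and "transpose W *v perron_vector W = perron_vector W" (is ?inv)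
proof -
  have "u = v" if "stochastic_vector u \<and> transpose W *v u = u"
    "stochastic_vector v \<and> transpose W *v v = v" for u v
  proof (rule vector_eq_rdot[THEN iffD1], rule allI)
    fix x
    have "(u \<bullet> x) *\<^sub>R (1 :: real ^ 'n) = (v \<bullet> x) *\<^sub>R 1"
      using that by (intro LIMSEQ_unique[OF invariant_vector_limit invariant_vector_limit])
        (auto simp: W prim)
    then show "u \<bullet> x = v \<bullet> x" by simp
  qed
  then have "\<exists>!v. stochastic_vector v \<and> transpose W *v v = v"
    using invariant_vector_exists[OF W prim] by blast
  from theI'[OF this] show ?stoch ?inv
    unfolding perron_vector_def by auto
qed

text \<open>By invariance under \<open>matrix_power W k\<close>, coordinate \<open>i\<close> is the
  average, with the Perron weights, of column \<open>i\<close> of a power whose entries are all at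
  least \<open>d > 0\<close>.\<close>

lemma perron_vector_pos:
  fixes W :: "real ^ 'n ^ 'n"
  assumes W: "stochastic_matrix W" and prim: "primitive_matrix W"
  shows "0 < perron_vector W $ i"
proof -
  let ?v = "perron_vector W"
  note v = perron_vector[OF W prim]
  obtain d k where d: "0 < d" "\<And>i j. d \<le> matrix_power W k $ i $ j"
    using primitive_matrix_power_bound[OF prim] by auto
  have "d = (\<Sum>j\<in>UNIV. ?v $ j * d)"
    using v(1) by (simp add: stochastic_vector_def flip: sum_distrib_right)
  also have "\<dots> \<le> (\<Sum>j\<in>UNIV. ?v $ j * matrix_power W k $ j $ i)"
    using v(1) by (intro sum_mono mult_left_mono d) (auto simp: stochastic_vector_def)
  also have "\<dots> = ?v \<bullet> (matrix_power W k *v axis i 1)"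
    by (simp add: inner_vec_def matrix_vector_mult_basis column_def)
  also have "\<dots> = ?v \<bullet> axis i 1"
    unfolding matrix_power_mult_vector
    by (induction k) (simp_all add: inner_mult_invariant[OF v(2)])
  also have "\<dots> = ?v $ i"
    by (simp add: inner_axis)
  finally show ?thesis
    using d(1) by simp
qed

text \<open>The orbit of a fixed point is constant, so it equals its limit, a multiple of
  \<open>1\<close>.\<close>

lemma primitive_fixed_point:
  fixes W :: "real ^ 'n ^ 'n"
  assumes "stochastic_matrix W" "primitive_matrix W" "W *v x = x"
  shows "\<exists>c. x = c *\<^sub>R 1"
proof -
  have "((*v) W ^^ t) x = x" for t
    by (induction t) (simp_all add: assms)
  then show ?thesis
    using primitive_powers_converge[OF assms(1,2), of x] by (simp add: LIMSEQ_const_iff)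
qed

section \<open>The trajectory under an input at time 0 only\<close>

lemma diag_mult_component: "(diag a *v x) $ i = a $ i * x $ i"
  by (simp add: diag_def matrix_vector_mult_def if_distrib[of "\<lambda>z. z * _"] sum.delta cong: if_cong)

text \<open>The input at time 0 already acts in forming the state at time 1, so iteration of
  \<open>W\<close> alone starts from that state and not from \<open>x0\<close>.\<close>

lemma trajectory_after_single_input:
  assumes "\<And>t. lam (Suc t) = 0"
  shows "trajectory W lam x0 (Suc t) = ((*v) W ^^ t) (trajectory W lam x0 1)"
proof (induction t)
  case (Suc t)
  have "trajectory W lam x0 (Suc (Suc t)) = W *v trajectory W lam x0 (Suc t)"
    by (simp add: vec_eq_iff diag_mult_component assms del: trajectory.simps(1))
  with Suc show ?case by simp
qed simp

theorem proposition3: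
  fixes W :: "real ^ 'n ^ 'n" and x0 :: "real ^ 'n"
  assumes "stochastic_matrix W"
    and "primitive_matrix W"
    and "\<forall>i. 0 < W $ i $ i"
    and "\<nexists>c. x0 = c *\<^sub>R 1"
  shows "\<exists>lam :: nat \<Rightarrow> real ^ 'n.
    (\<forall>t i. 0 \<le> lam t $ i \<and> lam t $ i \<le> 1) \<and>
    lam \<longlonglongrightarrow> 0 \<and>
    (\<exists>L. trajectory W lam x0 \<longlonglongrightarrow> L \<and>
         L \<noteq> (perron_vector W \<bullet> x0) *\<^sub>R 1)"
proof -
  note W = assms(1,2)
  let ?v = "perron_vector W"
  have "W *v x0 \<noteq> x0"
    using primitive_fixed_point[OF W] assms(4) by blast
  then obtain i where i: "(W *v x0) $ i \<noteq> x0 $ i"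
    by (auto simp: vec_eq_iff)
  define lam :: "nat \<Rightarrow> real ^ 'n" where "lam t = (if t = 0 then axis i 1 else 0)" for t
  define x1 where "x1 = trajectory W lam x0 1"
  \<comment> \<open>The input resets coordinate \<open>i\<close> of \<open>W *v x0\<close> to
    \<open>x0 $ i\<close> and leaves the other coordinates alone.\<close>
  have "x1 = W *v x0 + (x0 $ i - (W *v x0) $ i) *\<^sub>R axis i 1"
    by (simp add: x1_def lam_def vec_eq_iff diag_mult_component axis_def)
  then have "?v \<bullet> x1 = ?v \<bullet> x0 + (x0 $ i - (W *v x0) $ i) * ?v $ i"
    by (simp add: inner_add_right inner_mult_invariant[OF perron_vector(2)[OF W]] inner_axis)
  then have "?v \<bullet> x1 \<noteq> ?v \<bullet> x0"
    using i perron_vector_pos[OF W, of i] by simp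
  then have "(?v \<bullet> x1) *\<^sub>R (1 :: real ^ 'n) \<noteq> (?v \<bullet> x0) *\<^sub>R 1"
    by simp
  moreover have "(\<lambda>t. trajectory W lam x0 (Suc t)) \<longlonglongrightarrow> (?v \<bullet> x1) *\<^sub>R 1"
    using invariant_vector_limit[OF W perron_vector[OF W], of x1]
    by (subst trajectory_after_single_input) (simp_all add: lam_def[of "Suc _"] x1_def)
  then have "trajectory W lam x0 \<longlonglongrightarrow> (?v \<bullet> x1) *\<^sub>R 1"
    by (rule LIMSEQ_imp_Suc)
  moreover have "(\<lambda>t. lam (Suc t)) \<longlonglongrightarrow> 0"
    by (simp add: lam_def)
  then have "lam \<longlonglongrightarrow> 0"
    by (rule LIMSEQ_imp_Suc)
  moreover have "0 \<le> lam t $ j \<and> lam t $ j \<le> 1" for t j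
    by (simp add: lam_def axis_def)
  ultimately show ?thesis by blast
qed

end
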